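(* Let $q=p(p-1)/2$. If $$\liminf_{|x|\to\infty}\big(p\,\mathrm{pen}_D(|x|)+q\,\mathrm{pen}(x)-\log|x|\big)=-\infty,$$ then for every $p\times p$ matrix $S$ that is positive semidefinite but not positive definite, the penalised likelihood estimate $\hat\Theta_{\mathrm{Pen}}$ does not exist.
   Context: Fix an integer $p\ge 1$. All matrices are real symmetric $p\times p$; $\Theta=(\theta_{ij})\succ 0$ means $\Theta$ is positive definite. The diagonal penalty $\mathrm{pen}_D:(0,\infty)\to\mathbb{R}$ is non-negative, non-decreasing and continuous. The off-diagonal penalty $\mathrm{pen}:\mathbb{R}\to\mathbb{R}$ is non-negative, symmetric around $0$, non-decreasing in $|x|$ and continuous. Define $$\mathrm{Pen}(\Theta)=\sum_{i=1}^p \mathrm{pen}_D(\theta_{ii})+\sum_{i<j}\mathrm{pen}(\theta_{ij}),\qquad l_{\mathrm{Pen}}(\Theta\mid S)=\log\det\Theta-\mathrm{tr}(S\Theta)-\mathrm{Pen}(\Theta),\quad \Theta\succ 0.$$ The penalised likelihood estimate is $\hat\Theta_{\mathrm{Pen}}=\mathrm{argmax}_{\Theta\succ 0}\, l_{\mathrm{Pen}}(\Theta\mid S)$; it is said to exist if the supremum of $l_{\mathrm{Pen}}(\cdot\mid S)$ over positive definite $\Theta$ is finite and attained. *)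

theory Defs
  imports "HOL-Analysis.Analysis"
begin

text \<open>Real \<open>p \<times> p\<close> matrices are elements of \<^typ>\<open>real^'n^'n\<close> with \<open>p = CARD('n)\<close>. The index type
  carries a linear order only so that the sum over \<open>i < j\<close> makes sense.\<close>

type_synonym 'n sqmat = "real^'n^'n"

definition symmetric_mat :: "'n::finite sqmat \<Rightarrow> bool" where
  "symmetric_mat A \<longleftrightarrow> transpose A = A"

definition positive_semidefinite :: "'n::finite sqmat \<Rightarrow> bool" where
  "positive_semidefinite A \<longleftrightarrow> symmetric_mat A \<and> (\<forall>x. x \<bullet> (A *v x) \<ge> 0)"

definition positive_definite :: "'n::finite sqmat \<Rightarrow> bool" where
  "positive_definite A \<longleftrightarrow> symmetric_mat A \<and> (\<forall>x. x \<noteq> 0 \<longrightarrow> x \<bullet> (A *v x) > 0)"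

text \<open>The diagonal penalty is a function on \<open>(0, \<infinity>)\<close>; its values elsewhere are unconstrained and
  are never used on positive definite matrices, whose diagonal entries are positive.\<close>

definition diagonal_penalty :: "(real \<Rightarrow> real) \<Rightarrow> bool" where
  "diagonal_penalty penD \<longleftrightarrow>
     (\<forall>x>0. penD x \<ge> 0) \<and> mono_on {0<..} penD \<and> continuous_on {0<..} penD"

definition offdiagonal_penalty :: "(real \<Rightarrow> real) \<Rightarrow> bool" where
  "offdiagonal_penalty pen \<longleftrightarrow>
     (\<forall>x. pen x \<ge> 0) \<and> (\<forall>x. pen (- x) = pen x) \<and>
     (\<forall>x y. \<bar>x\<bar> \<le> \<bar>y\<bar> \<longrightarrow> pen x \<le> pen y) \<and> continuous_on UNIV pen"

definition Pen ::
  "(real \<Rightarrow> real) \<Rightarrow> (real \<Rightarrow> real) \<Rightarrow> 'n::{finite,linorder} sqmat \<Rightarrow> real" where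
  "Pen penD pen \<Theta> =
     (\<Sum>i\<in>UNIV. penD (\<Theta> $ i $ i)) + (\<Sum>(i, j)\<in>{(i, j). i < j}. pen (\<Theta> $ i $ j))"

definition lPen ::
  "(real \<Rightarrow> real) \<Rightarrow> (real \<Rightarrow> real) \<Rightarrow> 'n::{finite,linorder} sqmat \<Rightarrow> 'n sqmat \<Rightarrow> real" where
  "lPen penD pen S \<Theta> = ln (det \<Theta>) - trace (S ** \<Theta>) - Pen penD pen \<Theta>"

text \<open>The supremum is taken in the extended reals, so that it being finite is a genuine condition.\<close>

definition penalised_estimate_exists ::
  "(real \<Rightarrow> real) \<Rightarrow> (real \<Rightarrow> real) \<Rightarrow> 'n::{finite,linorder} sqmat \<Rightarrow> bool" where
  "penalised_estimate_exists penD pen S \<longleftrightarrow>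
     (let s = (SUP \<Theta>\<in>Collect positive_definite. ereal (lPen penD pen S \<Theta>))
      in \<bar>s\<bar> \<noteq> \<infinity> \<and> (\<exists>\<Theta>. positive_definite \<Theta> \<and> ereal (lPen penD pen S \<Theta>) = s))"

end

theory Submission
  imports Defs
begin

text \<open>A singular \<open>S\<close> has a unit vector \<open>v\<close> with \<open>v\<^sup>T S v = 0\<close>. Along the ray
  \<open>\<Theta>\<^sub>t = I + t v v\<^sup>T\<close> the trace term stays equal to the trace of \<open>S\<close>, the determinant is
  \<open>1 + t\<close>, and all entries are bounded by \<open>1 + t\<close> in absolute value. By monotonicity of the
  penalties, with \<open>x = 1 + t\<close>, the penalised likelihood is at least
  \<open>ln x - tr S - p pen\<^sub>D(x) - q pen(x)\<close>, which the hypothesis makes arbitrarily large.\<close>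

definition spike :: "real \<Rightarrow> real^'n \<Rightarrow> 'n::finite sqmat" where
  "spike t v = (\<chi> i j. (if i = j then 1 else 0) + t * (v $ i * v $ j))"

lemma spike_nth: "spike t v $ i $ j = (if i = j then 1 else 0) + t * (v $ i * v $ j)"
  by (simp add: spike_def)

text \<open>The rank-one part sends \<open>x\<close> to a multiple of \<open>v\<close>, namely
  \<open>(t * (v \<bullet> x)) *\<^sub>R v\<close>. For \<open>t \<ge> 0\<close> it thus adds a
  non-negative term to the form of the identity.\<close>

lemma inner_spike_mult:
  fixes x v :: "real^'n::finite"
  shows "x \<bullet> (spike t v *v x) = x \<bullet> x + t * (v \<bullet> x)\<^sup>2"
proof -
  have "(spike t v *v x) $ i = x $ i + t * v $ i * (v \<bullet> x)" for i
  proof -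
    have "(spike t v *v x) $ i
        = (\<Sum>j\<in>UNIV. (if i = j then x $ j else 0) + t * v $ i * (v $ j * x $ j))"
      unfolding matrix_vector_mult_def spike_nth
      by (auto simp: algebra_simps intro!: sum.cong)
    also have "\<dots> = x $ i + t * v $ i * (v \<bullet> x)"
      by (simp add: sum.distrib inner_vec_def sum_distrib_left)
    finally show ?thesis .
  qed
  then have "spike t v *v x = x + (t * (v \<bullet> x)) *\<^sub>R v"
    by (simp add: vec_eq_iff algebra_simps)
  then show ?thesis
    by (simp add: inner_add_right inner_commute power2_eq_square)
qed

lemma positive_definite_spike:
  assumes "t \<ge> 0"
  shows "positive_definite (spike t v)"
proof -
  have "transpose (spike t v) = spike t v"
    by (simp add: vec_eq_iff transpose_def spike_nth mult.commute)
  moreover have "x \<bullet> (spike t v *v x) > 0" if "x \<noteq> 0" for x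
    using that assms by (simp add: inner_spike_mult add_pos_nonneg)
  ultimately show ?thesis
    by (simp add: positive_definite_def symmetric_mat_def)
qed

text \<open>In an orthonormal basis containing \<open>v\<close> the matrix is diagonal, with
  eigenvalue \<open>1 + t\<close> on \<open>v\<close> and \<open>1\<close> on its orthogonal
  complement.\<close>

lemma det_spike:
  fixes v :: "real^'n::finite"
  assumes "norm v = 1"
  shows "det (spike t v) = 1 + t"
proof -
  \<comment> \<open>An arbitrary index, marking the column of \<open>A\<close> that equals
    \<open>v\<close>.\<close>
  obtain k :: 'n where True by simp
  obtain A where A: "orthogonal_matrix A" "A *v (axis k 1) = v"
    using orthogonal_matrix_exists_basis[OF assms] by metis
  have v: "v $ i = A $ i $ k" for i
    using A(2) matrix_vector_mul_component[of A "axis k 1" i] by (auto simp: inner_axis)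
  define D :: "'n sqmat" where "D = (\<chi> i j. if i = j then (if i = k then 1 + t else 1) else 0)"
  have AA: "A ** transpose A = mat 1"
    using A(1) by (simp add: orthogonal_matrix_def)
  have "(A ** D ** transpose A) $ i $ j = spike t v $ i $ j" for i j
  proof -
    have AD: "(A ** D) $ i $ l = A $ i $ l * (if l = k then 1 + t else 1)" for l
      by (simp add: matrix_matrix_mult_def D_def if_distrib[of "\<lambda>x. _ * x"] cong: if_cong)
    have "(A ** D ** transpose A) $ i $ j = (\<Sum>l\<in>UNIV. (A ** D) $ i $ l * A $ j $ l)"
      by (simp add: matrix_matrix_mult_def transpose_def)
    \<comment> \<open>Splitting the excess \<open>t\<close> off the \<open>k\<close>-th term leaves
      an entry of \<open>A ** transpose A\<close>, which is the identity, and an entry of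
      \<open>t v v^T\<close>.\<close>
    also have "\<dots> = (\<Sum>l\<in>UNIV. A $ i $ l * A $ j $ l + (if l = k then t * (A $ i $ l * A $ j $ l) else 0))"
      unfolding AD by (intro sum.cong) (auto simp: algebra_simps)
    also have "\<dots> = (A ** transpose A) $ i $ j + t * (v $ i * v $ j)"
      by (simp add: sum.distrib v matrix_matrix_mult_def transpose_def)
    finally show ?thesis
      by (simp add: AA spike_nth mat_def)
  qed
  then have "spike t v = A ** D ** transpose A"
    by (simp add: vec_eq_iff)
  then have "det (spike t v) = det D * (det A)\<^sup>2"
    by (simp add: det_mul det_transpose power2_eq_square)
  \<comment> \<open>\<open>det A\<close> is 1 or -1; its sign disappears in the square.\<close>
  also have "(det A)\<^sup>2 = 1"
    using det_orthogonal_matrix[OF A(1)] by auto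
  also have "det D = (\<Prod>i\<in>UNIV. if i = k then 1 + t else 1)"
    by (subst det_diagonal) (auto simp: D_def)
  finally show ?thesis by simp
qed

text \<open>Since the trace of \<open>S v v^T\<close> is the quadratic form of \<open>S\<close> at
  \<open>v\<close>, the trace is constant in \<open>t\<close> along a null direction.\<close>

lemma trace_mult_spike: "trace (S ** spike t v) = trace S + t * (v \<bullet> (S *v v))"
proof -
  have "(S ** spike t v) $ i $ i = S $ i $ i + t * (v $ i * (S *v v) $ i)" for i
  proof -
    have "(S ** spike t v) $ i $ i
        = (\<Sum>k\<in>UNIV. (if k = i then S $ i $ k else 0) + t * (v $ i * (S $ i $ k * v $ k)))"
      unfolding matrix_matrix_mult_def spike_nth
      by (auto simp: algebra_simps spike_nth intro!: sum.cong)
    then show ?thesis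
      by (simp add: sum.distrib matrix_vector_mult_def sum_distrib_left)
  qed
  then show ?thesis
    by (simp add: trace_def sum.distrib inner_vec_def sum_distrib_left)
qed

text \<open>Swapping coordinates pairs the entries above the diagonal with those below it, and the
  diagonal supplies the rest of the square.\<close>

lemma card_less_pairs:
  "card {(i, j :: 'n::{finite,linorder}). i < j} = CARD('n) * (CARD('n) - 1) div 2"
proof -
  let ?U = "{(i, j :: 'n). i < j}" and ?L = "{(i, j :: 'n). j < i}" and ?D = "{(i, j :: 'n). i = j}"
  have "card ?L = card ?U"
    by (rule bij_betw_same_card[of prod.swap]) (auto simp: bij_betw_def inj_on_def)
  moreover have "card ?D = CARD('n)"
    by (rule bij_betw_same_card[of fst]) (force simp: bij_betw_def inj_on_def)
  moreover have "card (?U \<union> ?L \<union> ?D) = card ?U + card ?L + card ?D"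
    by (subst card_Un_disjoint, force, force, force)+ simp
  moreover have "?U \<union> ?L \<union> ?D = UNIV \<times> UNIV" by auto
  ultimately have "CARD('n) * CARD('n) = 2 * card ?U + CARD('n)"
    by (simp add: card_cartesian_product)
  then have "CARD('n) * (CARD('n) - 1) = 2 * card ?U"
    by (simp add: diff_mult_distrib2)
  then show ?thesis by simp
qed

lemma Pen_le_entry_bound:
  fixes \<Theta> :: "'n::{finite,linorder} sqmat"
  assumes "diagonal_penalty penD" "offdiagonal_penalty pen" "positive_definite \<Theta>"
    and bound: "\<And>i j. \<bar>\<Theta> $ i $ j\<bar> \<le> x"
  shows "Pen penD pen \<Theta> \<le> real CARD('n) * penD x + real (CARD('n) * (CARD('n) - 1) div 2) * pen x"
proof -
  have "penD (\<Theta> $ i $ i) \<le> penD x" for i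
  proof -
    \<comment> \<open>\<open>penD\<close> is monotone only on positive arguments, so the diagonal
      entry must first be shown positive.\<close>
    have "axis i 1 \<bullet> (\<Theta> *v axis i 1) > 0"
      using assms(3) by (auto simp: positive_definite_def axis_eq_0_iff)
    then have "\<Theta> $ i $ i > 0"
      by (simp add: inner_axis' matrix_vector_mul_component inner_axis)
    then show ?thesis
      using assms(1) bound[of i i] by (auto simp: diagonal_penalty_def intro: mono_onD)
  qed
  then have "(\<Sum>i\<in>UNIV. penD (\<Theta> $ i $ i)) \<le> real CARD('n) * penD x"
    using sum_bounded_above[of UNIV "\<lambda>i. penD (\<Theta> $ i $ i)" "penD x"] by simp
  moreover have "pen (\<Theta> $ i $ j) \<le> pen x" for i j
    using assms(2) bound[of i j] unfolding offdiagonal_penalty_def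
    by (meson abs_ge_self order_trans)
  then have "(\<Sum>(i, j)\<in>{(i, j). i < j}. pen (\<Theta> $ i $ j))
      \<le> real (card {(i, j :: 'n). i < j}) * pen x"
    using sum_bounded_above[of "{(i, j). i < j}" "\<lambda>(i, j). pen (\<Theta> $ i $ j)" "pen x"]
    by (simp add: case_prod_beta)
  ultimately show ?thesis
    by (simp add: Pen_def card_less_pairs)
qed

text \<open>Where strict positivity fails, semidefiniteness forces the form to vanish; rescaling
  keeps it zero.\<close>

lemma exists_unit_null_direction:
  assumes "positive_semidefinite S" "\<not> positive_definite S"
  obtains v where "norm v = 1" "v \<bullet> (S *v v) = 0"
proof -
  obtain w where w: "w \<noteq> 0" "w \<bullet> (S *v w) = 0"
    using assms unfolding positive_semidefinite_def positive_definite_def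
    by (metis less_eq_real_def)
  show ?thesis
  proof
    show "norm ((1 / norm w) *\<^sub>R w) = 1" using w by simp
    show "((1 / norm w) *\<^sub>R w) \<bullet> (S *v ((1 / norm w) *\<^sub>R w)) = 0"
      using w by (simp add: matrix_vector_mult_scaleR)
  qed
qed

lemma lPen_spike_ge:
  fixes S :: "'n::{finite,linorder} sqmat"
  assumes "diagonal_penalty penD" "offdiagonal_penalty pen"
    and v: "norm v = 1" "v \<bullet> (S *v v) = 0" and "t \<ge> 0"
  shows "lPen penD pen S (spike t v) \<ge> ln (1 + t) - trace S
    - (real CARD('n) * penD (1 + t) + real (CARD('n) * (CARD('n) - 1) div 2) * pen (1 + t))"
proof -
  have "\<bar>spike t v $ i $ j\<bar> \<le> 1 + t" for i j
  proof -
    \<comment> \<open>Coordinates of a unit vector have absolute value at most 1.\<close>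
    have "\<bar>v $ i * v $ j\<bar> \<le> 1"
      using component_le_norm_cart[of v i] component_le_norm_cart[of v j] v(1)
      by (simp add: abs_mult mult_le_one)
    then have "\<bar>t * (v $ i * v $ j)\<bar> \<le> t"
      using \<open>t \<ge> 0\<close> by (simp add: abs_mult mult_left_le)
    then show ?thesis by (simp only: spike_nth) (auto split: if_splits)
  qed
  from Pen_le_entry_bound[OF assms(1,2) positive_definite_spike[OF \<open>t \<ge> 0\<close>] this]
  show ?thesis
    by (simp add: lPen_def det_spike trace_mult_spike v)
qed

text \<open>Otherwise \<open>c\<close> would eventually bound \<open>f\<close> from below on
  \<open>P\<close>, and so bound the limit inferior.\<close>

lemma Liminf_minus_infinity_below:
  fixes f :: "'a \<Rightarrow> real"
  assumes "Liminf F (\<lambda>x. ereal (f x)) = - \<infinity>" "eventually P F"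
  obtains x where "P x" "f x < c"
proof -
  have "\<exists>x. P x \<and> f x < c"
  proof (rule ccontr)
    assume "\<not> ?thesis"
    then have "eventually (\<lambda>x. ereal c \<le> ereal (f x)) F"
      by (intro eventually_mono[OF assms(2)]) (auto simp: not_less)
    then have "ereal c \<le> Liminf F (\<lambda>x. ereal (f x))"
      by (rule Liminf_bounded)
    with assms(1) show False by simp
  qed
  with that show ?thesis by blast
qed

theorem proposition9:
  fixes penD pen :: "real \<Rightarrow> real" and p q :: nat
  assumes "p = CARD('n::{finite,linorder})"
    and "q = p * (p - 1) div 2"
    and "diagonal_penalty penD"
    and "offdiagonal_penalty pen"
    and "Liminf at_infinity
           (\<lambda>x::real. ereal (real p * penD \<bar>x\<bar> + real q * pen x - ln \<bar>x\<bar>)) = - \<infinity>"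
  shows "\<forall>S::'n sqmat. positive_semidefinite S \<and> \<not> positive_definite S \<longrightarrow>
           \<not> penalised_estimate_exists penD pen S"
proof (intro allI impI notI)
  fix S :: "'n sqmat"
  assume S: "positive_semidefinite S \<and> \<not> positive_definite S"
    and ex: "penalised_estimate_exists penD pen S"
  obtain v where v: "norm v = 1" "v \<bullet> (S *v v) = 0"
    using S exists_unit_null_direction by blast
  obtain \<Theta> where \<Theta>: "ereal (lPen penD pen S \<Theta>)
      = (SUP \<Theta>\<in>Collect positive_definite. ereal (lPen penD pen S \<Theta>))"
    using ex unfolding penalised_estimate_exists_def Let_def by blast
  have max: "lPen penD pen S T \<le> lPen penD pen S \<Theta>" if "positive_definite T" for T
    using SUP_upper[of T "Collect positive_definite" "\<lambda>T. ereal (lPen penD pen S T)"] that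
    unfolding \<Theta>[symmetric] by simp
  have "eventually (\<lambda>x::real. \<bar>x\<bar> \<ge> 1) at_infinity"
    unfolding eventually_at_infinity by auto
  \<comment> \<open>The threshold makes the lower bound of \<open>lPen_spike_ge\<close> at
    \<open>t = \<bar>x\<bar> - 1\<close> exceed the supposed maximum;
    \<open>\<bar>x\<bar> \<ge> 1\<close> ensures \<open>t \<ge> 0\<close>.\<close>
  then obtain x where x: "\<bar>x\<bar> \<ge> 1"
    "real p * penD \<bar>x\<bar> + real q * pen x - ln \<bar>x\<bar> < - trace S - lPen penD pen S \<Theta>"
    using Liminf_minus_infinity_below[OF assms(5)] by blast
  \<comment> \<open>The witness \<open>x\<close> may be negative, while the bound is stated at
    \<open>1 + t = \<bar>x\<bar>\<close>; symmetry of \<open>pen\<close> reconciles them.\<close>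
  have "pen \<bar>x\<bar> = pen x"
    using assms(4) by (simp add: offdiagonal_penalty_def abs_if)
  with lPen_spike_ge[OF assms(3,4) v, of "\<bar>x\<bar> - 1"] x
  have "lPen penD pen S (spike (\<bar>x\<bar> - 1) v) > lPen penD pen S \<Theta>"
    by (simp add: assms(1,2))
  moreover have "positive_definite (spike (\<bar>x\<bar> - 1) v)"
    using x(1) by (intro positive_definite_spike) simp
  ultimately show False using max by fastforce
qed

end
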